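(* Let $H$ and $G$ be groups and let $P = H\ast G$ be their free product, with $H$ and $G$ regarded as subgroups of $P$. Let $U \subset \langle P\rangle$ be the set of conjugacy classes $\hat x$ of $P$ such that $\hat x \cap G = \emptyset$ and $\hat x\cap H = \emptyset$. Then: (1) The set of conjugacy classes of $P$ decomposes as a disjoint union $$\langle P\rangle = \{e_P\} \sqcup (\langle H\rangle \setminus \{e_H\}) \sqcup (\langle G\rangle\setminus\{e_G\}) \sqcup U,$$ where $\langle H\rangle\setminus\{e_H\}$ and $\langle G\rangle\setminus\{e_G\}$ are identified with subsets of $\langle P \rangle$ via the maps induced by the inclusions $H\subset P$ and $G\subset P$. (2) For every nontrivial element $x \in G\subset P$ the centralizer of $x$ in $P$ equals the centralizer of $x$ in $G$, and for every nontrivial element $x\in H\subset P$ the centralizer of $x$ in $P$ equals the centralizer of $x$ in $H$. (3) For every $\hat x\in U$ and every $x\in\hat x$, the pair (group, subgroup) $(P_x, \{x\})$ is isomorphic to the pair $(\mathbb Z, k(x)\mathbb Z)$, where $k(x)$ is the largest integer $k$ such that $x = y^k$ for some $y\in P$; hence $N_x \simeq \mathbb Z_{k(x)}$.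
   Context: For a group $\Gamma$ and $x\in \Gamma$: $\Gamma_x = \{y\in \Gamma \mid yx = xy\}$ is the centralizer of $x$; $\{x\}$ denotes the subgroup of $\Gamma$ generated by $x$; $N_x = \Gamma_x/\{x\}$; $\langle \Gamma\rangle$ is the set of conjugacy classes of elements of $\Gamma$; $\hat x$ is the conjugacy class of $x$; $e_\Gamma$ is the neutral element of $\Gamma$, and also stands for its conjugacy class. In (3), $P_x$ and $N_x$ are taken with $\Gamma=P$. $\mathbb Z_k$ denotes the finite cyclic group of order $k$. An isomorphism of pairs $(A,B)\cong (A',B')$ (group, subgroup) is a group isomorphism $A\to A'$ carrying $B$ onto $B'$. *)

theory Defs
  imports "HOL-Algebra.Elementary_Groups"
begin

section \<open>Conjugacy classes, centralizers, roots\<close>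

definition conj_class :: "('a, 'm) monoid_scheme \<Rightarrow> 'a \<Rightarrow> 'a set" where
  "conj_class \<Gamma> x = {g \<otimes>\<^bsub>\<Gamma>\<^esub> x \<otimes>\<^bsub>\<Gamma>\<^esub> inv\<^bsub>\<Gamma>\<^esub> g | g. g \<in> carrier \<Gamma>}"

definition conj_classes :: "('a, 'm) monoid_scheme \<Rightarrow> 'a set set" where
  "conj_classes \<Gamma> = conj_class \<Gamma> ` carrier \<Gamma>"

text \<open>For a homomorphism \<open>f : \<Gamma> \<rightarrow> \<Delta>\<close>, all \<open>f x\<close> with \<open>x \<in> C\<close> have the same class in \<open>\<Delta>\<close>,
  so the union below is that class; see \<open>induced_class_map_conj_class\<close>.\<close>

definition induced_class_map :: "('b, 'n) monoid_scheme \<Rightarrow> ('a \<Rightarrow> 'b) \<Rightarrow> 'a set \<Rightarrow> 'b set" where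
  "induced_class_map \<Delta> f C = (\<Union>x\<in>C. conj_class \<Delta> (f x))"

definition centralizer :: "('a, 'm) monoid_scheme \<Rightarrow> 'a \<Rightarrow> 'a set" where
  "centralizer \<Gamma> x = {y \<in> carrier \<Gamma>. y \<otimes>\<^bsub>\<Gamma>\<^esub> x = x \<otimes>\<^bsub>\<Gamma>\<^esub> y}"

definition centralizer_group :: "('a, 'm) monoid_scheme \<Rightarrow> 'a \<Rightarrow> ('a, 'm) monoid_scheme" where
  "centralizer_group \<Gamma> x = \<Gamma>\<lparr>carrier := centralizer \<Gamma> x\<rparr>"

definition reduced_centralizer :: "('a, 'm) monoid_scheme \<Rightarrow> 'a \<Rightarrow> 'a set monoid" where
  "reduced_centralizer \<Gamma> x = centralizer_group \<Gamma> x Mod generate \<Gamma> {x}"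

definition root_exponents :: "('a, 'm) monoid_scheme \<Rightarrow> 'a \<Rightarrow> int set" where
  "root_exponents \<Gamma> x = {k. \<exists>y\<in>carrier \<Gamma>. x = y [^]\<^bsub>\<Gamma>\<^esub> k}"

text \<open>Meaningful only if \<open>root_exponents \<Gamma> x\<close> has a greatest element.\<close>

definition max_root_exponent :: "('a, 'm) monoid_scheme \<Rightarrow> 'a \<Rightarrow> int" where
  "max_root_exponent \<Gamma> x = (GREATEST k. k \<in> root_exponents \<Gamma> x)"

definition pair_iso ::
  "('a, 'm) monoid_scheme \<Rightarrow> 'a set \<Rightarrow> ('b, 'n) monoid_scheme \<Rightarrow> 'b set \<Rightarrow> bool" where
  "pair_iso A B A' B' \<longleftrightarrow> (\<exists>f\<in>iso A A'. f ` B = B')"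

lemma induced_class_map_conj_class:
  assumes "group \<Gamma>" "group \<Delta>" "f \<in> hom \<Gamma> \<Delta>" "x \<in> carrier \<Gamma>"
  shows "induced_class_map \<Delta> f (conj_class \<Gamma> x) = conj_class \<Delta> (f x)"
proof -
  interpret f: group_hom \<Gamma> \<Delta> f
    using assms by (simp add: group_hom_def group_hom_axioms_def)
  have fx: "f x \<in> carrier \<Delta>" using assms by simp
  have conj: "conj_class \<Delta> (h \<otimes>\<^bsub>\<Delta>\<^esub> f x \<otimes>\<^bsub>\<Delta>\<^esub> inv\<^bsub>\<Delta>\<^esub> h) \<subseteq> conj_class \<Delta> (f x)"
    if "h \<in> carrier \<Delta>" for h
  proof
    fix z assume "z \<in> conj_class \<Delta> (h \<otimes>\<^bsub>\<Delta>\<^esub> f x \<otimes>\<^bsub>\<Delta>\<^esub> inv\<^bsub>\<Delta>\<^esub> h)"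
    then obtain g where g: "g \<in> carrier \<Delta>"
      "z = g \<otimes>\<^bsub>\<Delta>\<^esub> (h \<otimes>\<^bsub>\<Delta>\<^esub> f x \<otimes>\<^bsub>\<Delta>\<^esub> inv\<^bsub>\<Delta>\<^esub> h) \<otimes>\<^bsub>\<Delta>\<^esub> inv\<^bsub>\<Delta>\<^esub> g"
      by (auto simp: conj_class_def)
    then have "z = (g \<otimes>\<^bsub>\<Delta>\<^esub> h) \<otimes>\<^bsub>\<Delta>\<^esub> f x \<otimes>\<^bsub>\<Delta>\<^esub> inv\<^bsub>\<Delta>\<^esub> (g \<otimes>\<^bsub>\<Delta>\<^esub> h)"
      using that fx by (simp add: f.H.inv_mult_group f.H.m_assoc)
    then show "z \<in> conj_class \<Delta> (f x)"
      using g that unfolding conj_class_def by blast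
  qed
  show ?thesis
  proof
    show "induced_class_map \<Delta> f (conj_class \<Gamma> x) \<subseteq> conj_class \<Delta> (f x)"
    proof
      fix z assume "z \<in> induced_class_map \<Delta> f (conj_class \<Gamma> x)"
      then obtain g where g: "g \<in> carrier \<Gamma>"
        "z \<in> conj_class \<Delta> (f (g \<otimes>\<^bsub>\<Gamma>\<^esub> x \<otimes>\<^bsub>\<Gamma>\<^esub> inv\<^bsub>\<Gamma>\<^esub> g))"
        unfolding induced_class_map_def conj_class_def[of \<Gamma>] by blast
      then show "z \<in> conj_class \<Delta> (f x)"
        using conj[of "f g"] assms(4) by auto
    qed
    have "x = \<one>\<^bsub>\<Gamma>\<^esub> \<otimes>\<^bsub>\<Gamma>\<^esub> x \<otimes>\<^bsub>\<Gamma>\<^esub> inv\<^bsub>\<Gamma>\<^esub> \<one>\<^bsub>\<Gamma>\<^esub>" using assms(4) by simp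
    then have "x \<in> conj_class \<Gamma> x" unfolding conj_class_def by blast
    then show "conj_class \<Delta> (f x) \<subseteq> induced_class_map \<Delta> f (conj_class \<Gamma> x)"
      unfolding induced_class_map_def by blast
  qed
qed


section \<open>The free product of two groups\<close>

text \<open>Elements are the reduced words: alternating lists of nontrivial letters from the two
  factors. The product is concatenation followed by reduction. Below it is shown
  that this is a group with the universal property of the coproduct.\<close>

definition fp_letters :: "('a, 'm) monoid_scheme \<Rightarrow> ('b, 'n) monoid_scheme \<Rightarrow> ('a + 'b) set" where
  "fp_letters H G = (carrier H - {\<one>\<^bsub>H\<^esub>}) <+> (carrier G - {\<one>\<^bsub>G\<^esub>})"

definition reduced_words ::
  "('a, 'm) monoid_scheme \<Rightarrow> ('b, 'n) monoid_scheme \<Rightarrow> ('a + 'b) list set" where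
  "reduced_words H G =
     {w. set w \<subseteq> fp_letters H G \<and> successively (\<lambda>a b. isl a \<noteq> isl b) w}"

text \<open>Multiplication of a reduced word by a single nontrivial letter on the left.\<close>

fun fp_cons :: "('a, 'm) monoid_scheme \<Rightarrow> ('b, 'n) monoid_scheme \<Rightarrow>
    'a + 'b \<Rightarrow> ('a + 'b) list \<Rightarrow> ('a + 'b) list" where
  "fp_cons H G (Inl h) (Inl h' # w) =
     (if h \<otimes>\<^bsub>H\<^esub> h' = \<one>\<^bsub>H\<^esub> then w else Inl (h \<otimes>\<^bsub>H\<^esub> h') # w)"
| "fp_cons H G (Inr g) (Inr g' # w) =
     (if g \<otimes>\<^bsub>G\<^esub> g' = \<one>\<^bsub>G\<^esub> then w else Inr (g \<otimes>\<^bsub>G\<^esub> g') # w)"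
| "fp_cons H G a w = a # w"

definition free_product ::
  "('a, 'm) monoid_scheme \<Rightarrow> ('b, 'n) monoid_scheme \<Rightarrow> ('a + 'b) list monoid" where
  "free_product H G =
     \<lparr>carrier = reduced_words H G, mult = foldr (fp_cons H G), one = []\<rparr>"

definition fp_inl :: "('a, 'm) monoid_scheme \<Rightarrow> 'a \<Rightarrow> ('a + 'b) list" where
  "fp_inl H h = (if h = \<one>\<^bsub>H\<^esub> then [] else [Inl h])"

definition fp_inr :: "('b, 'n) monoid_scheme \<Rightarrow> 'b \<Rightarrow> ('a + 'b) list" where
  "fp_inr G g = (if g = \<one>\<^bsub>G\<^esub> then [] else [Inr g])"

context
  fixes H :: "('a, 'm) monoid_scheme" and G :: "('b, 'n) monoid_scheme"
  assumes H: "group H" and G: "group G"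
begin

interpretation H: group H by (rule H)
interpretation G: group G by (rule G)

lemma Nil_reduced [simp]: "[] \<in> reduced_words H G"
  by (simp add: reduced_words_def)

lemma reduced_ConsD:
  assumes "a # w \<in> reduced_words H G"
  shows "a \<in> fp_letters H G" "w \<in> reduced_words H G"
  using assms by (auto simp: reduced_words_def successively_Cons)

lemma fp_cons_Cons: "a # w \<in> reduced_words H G \<Longrightarrow> fp_cons H G a w = a # w"
  by (cases "(H, G, a, w)" rule: fp_cons.cases) (auto simp: reduced_words_def)

lemma fp_cons_closed:
  assumes "a \<in> fp_letters H G" "w \<in> reduced_words H G"
  shows "fp_cons H G a w \<in> reduced_words H G"
  using assms
  by (cases "(H, G, a, w)" rule: fp_cons.cases)
     (auto simp: reduced_words_def fp_letters_def successively_Cons)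

lemma foldr_fp_cons_closed:
  assumes "set u \<subseteq> fp_letters H G" "w \<in> reduced_words H G"
  shows "foldr (fp_cons H G) u w \<in> reduced_words H G"
  using assms by (induction u) (auto intro: fp_cons_closed)

lemma fp_cons_Inl_Inl:
  assumes "Inl h \<in> fp_letters H G" "Inl h' \<in> fp_letters H G" "w \<in> reduced_words H G"
  shows "fp_cons H G (Inl h) (fp_cons H G (Inl h') w) =
    (if h \<otimes>\<^bsub>H\<^esub> h' = \<one>\<^bsub>H\<^esub> then w else fp_cons H G (Inl (h \<otimes>\<^bsub>H\<^esub> h')) w)"
proof (cases w)
  case (Cons c v)
  show ?thesis
  proof (cases c)
    case (Inl k)
    have k: "h \<in> carrier H" "h' \<in> carrier H" "k \<in> carrier H" "k \<noteq> \<one>\<^bsub>H\<^esub>" "h \<noteq> \<one>\<^bsub>H\<^esub>"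
      using assms Cons Inl by (auto simp: reduced_words_def fp_letters_def)
    have a: "h \<otimes>\<^bsub>H\<^esub> (h' \<otimes>\<^bsub>H\<^esub> k) = h \<otimes>\<^bsub>H\<^esub> h' \<otimes>\<^bsub>H\<^esub> k" using k by (simp add: H.m_assoc)
    have v: "fp_cons H G (Inl h) v = Inl h # v"
      using assms(3) Cons Inl by (cases v rule: list.exhaust; cases "hd v") (auto simp: reduced_words_def)
    have a1: "h \<otimes>\<^bsub>H\<^esub> h' \<otimes>\<^bsub>H\<^esub> k = h" if "h' \<otimes>\<^bsub>H\<^esub> k = \<one>\<^bsub>H\<^esub>"
      using a that k by simp
    have a2: "h \<otimes>\<^bsub>H\<^esub> h' \<otimes>\<^bsub>H\<^esub> k = k" if "h \<otimes>\<^bsub>H\<^esub> h' = \<one>\<^bsub>H\<^esub>"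
      using that k by simp
    show ?thesis using Cons Inl k a v a1 a2 by auto
  qed (use Cons in auto)
qed simp

lemma fp_cons_Inr_Inr:
  assumes "Inr g \<in> fp_letters H G" "Inr g' \<in> fp_letters H G" "w \<in> reduced_words H G"
  shows "fp_cons H G (Inr g) (fp_cons H G (Inr g') w) =
    (if g \<otimes>\<^bsub>G\<^esub> g' = \<one>\<^bsub>G\<^esub> then w else fp_cons H G (Inr (g \<otimes>\<^bsub>G\<^esub> g')) w)"
proof (cases w)
  case (Cons c v)
  show ?thesis
  proof (cases c)
    case (Inr k)
    have k: "g \<in> carrier G" "g' \<in> carrier G" "k \<in> carrier G" "k \<noteq> \<one>\<^bsub>G\<^esub>" "g \<noteq> \<one>\<^bsub>G\<^esub>"
      using assms Cons Inr by (auto simp: reduced_words_def fp_letters_def)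
    have a: "g \<otimes>\<^bsub>G\<^esub> (g' \<otimes>\<^bsub>G\<^esub> k) = g \<otimes>\<^bsub>G\<^esub> g' \<otimes>\<^bsub>G\<^esub> k" using k by (simp add: G.m_assoc)
    have v: "fp_cons H G (Inr g) v = Inr g # v"
      using assms(3) Cons Inr by (cases v rule: list.exhaust; cases "hd v") (auto simp: reduced_words_def)
    have a1: "g \<otimes>\<^bsub>G\<^esub> g' \<otimes>\<^bsub>G\<^esub> k = g" if "g' \<otimes>\<^bsub>G\<^esub> k = \<one>\<^bsub>G\<^esub>"
      using a that k by simp
    have a2: "g \<otimes>\<^bsub>G\<^esub> g' \<otimes>\<^bsub>G\<^esub> k = k" if "g \<otimes>\<^bsub>G\<^esub> g' = \<one>\<^bsub>G\<^esub>"
      using that k by simp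
    show ?thesis using Cons Inr k a v a1 a2 by auto
  qed (use Cons in auto)
qed simp

lemma foldr_fp_cons:
  assumes "a \<in> fp_letters H G" "v \<in> reduced_words H G" "w \<in> reduced_words H G"
  shows "foldr (fp_cons H G) (fp_cons H G a v) w = fp_cons H G a (foldr (fp_cons H G) v w)"
proof (cases v)
  case (Cons b v')
  have b: "b \<in> fp_letters H G" "v' \<in> reduced_words H G"
    using assms(2) Cons reduced_ConsD by blast+
  have x: "foldr (fp_cons H G) v' w \<in> reduced_words H G"
    using b assms(3) by (intro foldr_fp_cons_closed) (auto simp: reduced_words_def)
  show ?thesis
    using assms(1) b x Cons
    by (cases a; cases b) (simp_all add: fp_cons_Inl_Inl fp_cons_Inr_Inr)
qed simp

lemma group_free_product: "group (free_product H G)"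
proof (rule groupI)
  fix u v assume "u \<in> carrier (free_product H G)" "v \<in> carrier (free_product H G)"
  then show "u \<otimes>\<^bsub>free_product H G\<^esub> v \<in> carrier (free_product H G)"
    using foldr_fp_cons_closed[of u v] by (simp add: free_product_def reduced_words_def)
next
  fix u v w
  assume uvw: "u \<in> carrier (free_product H G)" "v \<in> carrier (free_product H G)"
    "w \<in> carrier (free_product H G)"
  then have v: "v \<in> reduced_words H G" and w: "w \<in> reduced_words H G"
    and u: "set u \<subseteq> fp_letters H G"
    by (auto simp: free_product_def reduced_words_def)
  have "foldr (fp_cons H G) (foldr (fp_cons H G) u v) w
      = foldr (fp_cons H G) u (foldr (fp_cons H G) v w)"
    using u by (induction u) (auto simp: foldr_fp_cons foldr_fp_cons_closed v w)
  then show "u \<otimes>\<^bsub>free_product H G\<^esub> v \<otimes>\<^bsub>free_product H G\<^esub> w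
      = u \<otimes>\<^bsub>free_product H G\<^esub> (v \<otimes>\<^bsub>free_product H G\<^esub> w)"
    by (simp add: free_product_def)
next
  fix u assume "u \<in> carrier (free_product H G)"
  then have "u \<in> reduced_words H G" by (simp add: free_product_def)
  then have "\<exists>u'. set u' \<subseteq> fp_letters H G \<and> foldr (fp_cons H G) u' u = []"
  proof (induction u)
    case (Cons a u)
    then obtain u' where u': "set u' \<subseteq> fp_letters H G" "foldr (fp_cons H G) u' u = []"
      using reduced_ConsD by blast
    have a: "a \<in> fp_letters H G" using Cons reduced_ConsD by blast
    have "\<exists>b\<in>fp_letters H G. fp_cons H G b (a # u) = u"
    proof (cases a)
      case (Inl h)
      then show ?thesis using a
        by (intro bexI[of _ "Inl (inv\<^bsub>H\<^esub> h)"]) (auto simp: fp_letters_def)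
    next
      case (Inr g)
      then show ?thesis using a
        by (intro bexI[of _ "Inr (inv\<^bsub>G\<^esub> g)"]) (auto simp: fp_letters_def)
    qed
    then obtain b where "b \<in> fp_letters H G" "fp_cons H G b (a # u) = u" by blast
    then show ?case using u' by (intro exI[of _ "u' @ [b]"]) auto
  qed (rule exI[of _ "[]"], simp)
  then obtain u' where u': "set u' \<subseteq> fp_letters H G" "foldr (fp_cons H G) u' u = []" by blast
  define y where "y = foldr (fp_cons H G) u' []"
  have "y \<in> reduced_words H G" unfolding y_def using u' by (simp add: foldr_fp_cons_closed)
  moreover have "foldr (fp_cons H G) y u = foldr (fp_cons H G) u' u"
    unfolding y_def using u'(1) \<open>u \<in> reduced_words H G\<close>
    by (induction u') (auto simp: foldr_fp_cons foldr_fp_cons_closed)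
  ultimately show "\<exists>y\<in>carrier (free_product H G). y \<otimes>\<^bsub>free_product H G\<^esub> u = \<one>\<^bsub>free_product H G\<^esub>"
    using u' by (auto simp: free_product_def)
qed (simp_all add: free_product_def)

lemma fp_inl_hom: "fp_inl H \<in> hom H (free_product H G)"
  by (rule homI) (auto simp: fp_inl_def free_product_def reduced_words_def fp_letters_def)

lemma fp_inr_hom: "fp_inr G \<in> hom G (free_product H G)"
  by (rule homI) (auto simp: fp_inr_def free_product_def reduced_words_def fp_letters_def)

lemma inj_fp_inl: "inj (fp_inl H)"
  by (auto simp: inj_def fp_inl_def split: if_splits)

lemma inj_fp_inr: "inj (fp_inr G)"
  by (auto simp: inj_def fp_inr_def split: if_splits)

theorem free_product_universal:
  fixes K :: "('c, 'k) monoid_scheme"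
  assumes K: "group K" and f: "f \<in> hom H K" and g: "g \<in> hom G K"
  shows "\<exists>\<phi>\<in>hom (free_product H G) K.
      (\<forall>x\<in>carrier H. \<phi> (fp_inl H x) = f x) \<and> (\<forall>x\<in>carrier G. \<phi> (fp_inr G x) = g x) \<and>
      (\<forall>\<psi>\<in>hom (free_product H G) K.
        (\<forall>x\<in>carrier H. \<psi> (fp_inl H x) = f x) \<and> (\<forall>x\<in>carrier G. \<psi> (fp_inr G x) = g x)
        \<longrightarrow> (\<forall>w\<in>carrier (free_product H G). \<psi> w = \<phi> w))"
proof -
  interpret K: group K by (rule K)
  interpret f: group_hom H K f using f by unfold_locales
  interpret g: group_hom G K g using g by unfold_locales
  interpret P: group "free_product H G" by (rule group_free_product)
  define F where "F = case_sum f g"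
  define \<phi> where "\<phi> w = foldr (\<lambda>a z. F a \<otimes>\<^bsub>K\<^esub> z) w \<one>\<^bsub>K\<^esub>" for w
  have F: "F a \<in> carrier K" if "a \<in> fp_letters H G" for a
    using that by (auto simp: F_def fp_letters_def)
  have cl: "\<phi> w \<in> carrier K" if "set w \<subseteq> fp_letters H G" for w
    using that by (induction w) (auto simp: \<phi>_def F)
  have cons: "\<phi> (fp_cons H G a w) = F a \<otimes>\<^bsub>K\<^esub> \<phi> w"
    if "a \<in> fp_letters H G" "set w \<subseteq> fp_letters H G" for a w
  proof (cases "(H, G, a, w)" rule: fp_cons.cases)
    case (1 H' G' h h' v)
    then have aw: "a = Inl h" "w = Inl h' # v" by auto
    have c: "h \<in> carrier H" "h' \<in> carrier H" "\<phi> v \<in> carrier K"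
      using aw that cl[of v] by (auto simp: fp_letters_def)
    have "F a \<otimes>\<^bsub>K\<^esub> \<phi> w = f h \<otimes>\<^bsub>K\<^esub> (f h' \<otimes>\<^bsub>K\<^esub> \<phi> v)"
      by (simp add: aw F_def \<phi>_def)
    also have "\<dots> = f (h \<otimes>\<^bsub>H\<^esub> h') \<otimes>\<^bsub>K\<^esub> \<phi> v"
      using c by (simp add: K.m_assoc)
    also have "\<dots> = \<phi> (fp_cons H G a w)"
    proof (cases "h \<otimes>\<^bsub>H\<^esub> h' = \<one>\<^bsub>H\<^esub>")
      case True
      then have "f (h \<otimes>\<^bsub>H\<^esub> h') = \<one>\<^bsub>K\<^esub>" by (simp only: f.hom_one)
      then show ?thesis using True c(3) by (simp add: aw)
    next
      case False
      then show ?thesis by (simp add: aw \<phi>_def F_def)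
    qed
    finally show ?thesis ..
  next
    case (2 H' G' h h' v)
    then have aw: "a = Inr h" "w = Inr h' # v" by auto
    have c: "h \<in> carrier G" "h' \<in> carrier G" "\<phi> v \<in> carrier K"
      using aw that cl[of v] by (auto simp: fp_letters_def)
    have "F a \<otimes>\<^bsub>K\<^esub> \<phi> w = g h \<otimes>\<^bsub>K\<^esub> (g h' \<otimes>\<^bsub>K\<^esub> \<phi> v)"
      by (simp add: aw F_def \<phi>_def)
    also have "\<dots> = g (h \<otimes>\<^bsub>G\<^esub> h') \<otimes>\<^bsub>K\<^esub> \<phi> v"
      using c by (simp add: K.m_assoc)
    also have "\<dots> = \<phi> (fp_cons H G a w)"
    proof (cases "h \<otimes>\<^bsub>G\<^esub> h' = \<one>\<^bsub>G\<^esub>")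
      case True
      then have "g (h \<otimes>\<^bsub>G\<^esub> h') = \<one>\<^bsub>K\<^esub>" by (simp only: g.hom_one)
      then show ?thesis using True c(3) by (simp add: aw)
    next
      case False
      then show ?thesis by (simp add: aw \<phi>_def F_def)
    qed
    finally show ?thesis ..
  qed (simp_all add: \<phi>_def)
  have mult: "\<phi> (foldr (fp_cons H G) u w) = \<phi> u \<otimes>\<^bsub>K\<^esub> \<phi> w"
    if "set u \<subseteq> fp_letters H G" "w \<in> reduced_words H G" for u w
    using that(1)
  proof (induction u)
    case Nil
    then show ?case using cl[of w] that(2) by (simp add: \<phi>_def reduced_words_def)
  next
    case (Cons a u)
    have "foldr (fp_cons H G) u w \<in> reduced_words H G"
      using Cons.prems that(2) by (intro foldr_fp_cons_closed) auto
    then have "\<phi> (foldr (fp_cons H G) (a # u) w) = F a \<otimes>\<^bsub>K\<^esub> (\<phi> u \<otimes>\<^bsub>K\<^esub> \<phi> w)"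
      using Cons cons by (simp add: reduced_words_def)
    moreover have "\<phi> (a # u) = F a \<otimes>\<^bsub>K\<^esub> \<phi> u" by (simp add: \<phi>_def)
    ultimately show ?case
      using Cons.prems that(2) F cl[of u] cl[of w] by (simp add: K.m_assoc reduced_words_def)
  qed
  have hom: "\<phi> \<in> hom (free_product H G) K"
    by (rule homI) (auto simp: free_product_def reduced_words_def mult cl)
  have uniq: "\<psi> w = \<phi> w"
    if \<psi>: "\<psi> \<in> hom (free_product H G) K" "\<forall>x\<in>carrier H. \<psi> (fp_inl H x) = f x"
      "\<forall>x\<in>carrier G. \<psi> (fp_inr G x) = g x" and w: "w \<in> reduced_words H G" for \<psi> w
    using w
  proof (induction w)
    case Nil
    interpret psi: group_hom "free_product H G" K \<psi> using \<psi>(1) by unfold_locales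
    show ?case using psi.hom_one by (simp add: free_product_def \<phi>_def)
  next
    case (Cons a w)
    have a: "a \<in> fp_letters H G" "w \<in> reduced_words H G" using reduced_ConsD[OF Cons.prems] .
    have 1: "[a] \<otimes>\<^bsub>free_product H G\<^esub> w = a # w"
      using fp_cons_Cons[OF Cons.prems] by (simp add: free_product_def)
    have 2: "\<psi> [a] = F a"
    proof (cases a)
      case (Inl h)
      then have "h \<in> carrier H" "h \<noteq> \<one>\<^bsub>H\<^esub>" using a(1) by (auto simp: fp_letters_def)
      then show ?thesis using bspec[OF \<psi>(2), of h] by (simp add: Inl F_def fp_inl_def)
    next
      case (Inr h)
      then have "h \<in> carrier G" "h \<noteq> \<one>\<^bsub>G\<^esub>" using a(1) by (auto simp: fp_letters_def)
      then show ?thesis using bspec[OF \<psi>(3), of h] by (simp add: Inr F_def fp_inr_def)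
    qed
    have "\<psi> ([a] \<otimes>\<^bsub>free_product H G\<^esub> w) = \<psi> [a] \<otimes>\<^bsub>K\<^esub> \<psi> w"
      using a by (intro hom_mult[OF \<psi>(1)]) (auto simp: free_product_def reduced_words_def)
    then show ?case using 1 2 Cons.IH[OF a(2)] by (simp add: \<phi>_def)
  qed
  show ?thesis
  proof (rule bexI[OF _ hom], intro conjI ballI impI)
    show "\<phi> (fp_inl H x) = f x" if "x \<in> carrier H" for x
      using that by (simp add: fp_inl_def \<phi>_def F_def)
    show "\<phi> (fp_inr G x) = g x" if "x \<in> carrier G" for x
      using that by (simp add: fp_inr_def \<phi>_def F_def)
    show "\<psi> w = \<phi> w"
      if "\<psi> \<in> hom (free_product H G) K"
        "(\<forall>x\<in>carrier H. \<psi> (fp_inl H x) = f x) \<and> (\<forall>x\<in>carrier G. \<psi> (fp_inr G x) = g x)"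
        "w \<in> carrier (free_product H G)" for \<psi> w
      using uniq that by (simp add: free_product_def)
  qed
qed

end

end

theory Submission
  imports Defs "HOL-Algebra.Multiplicative_Group"
begin

text \<open>
  Write \<open>P = H * G\<close>, realised by reduced words.

  The homomorphism \<open>P \<rightarrow> H\<close> that is the identity on \<open>H\<close> and trivial on \<open>G\<close>, and its counterpart
  \<open>P \<rightarrow> G\<close>, show that two elements of \<open>H\<close> that are conjugate in \<open>P\<close> are conjugate in \<open>H\<close>
  (\<open>conj_class_inl_iff\<close>), and that an element of \<open>H\<close> conjugate to an element of \<open>G\<close> is trivial
  (\<open>conj_class_inl_inr\<close>). This gives the decomposition of the set of conjugacy classes.

  If \<open>a\<close> is a letter and \<open>y\<close> a reduced word with at least two letters, then \<open>a y\<close> and \<open>y a\<close> have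
  different last letters, and a single letter of the other factor does not commute with \<open>a\<close>
  either. Hence everything that commutes with \<open>a\<close> lies in the same factor as \<open>a\<close>
  (\<open>centralizer_letter\<close>).

  A class that meets neither factor contains a nonempty cyclically reduced word \<open>w\<close>, whose first
  and last letters lie in different factors (\<open>conj_class_oriented\<close>). If \<open>y\<close> commutes with \<open>w\<close>, then
  for large \<open>n\<close> the word \<open>v = y w^n = w^n y\<close> begins with a letter of the same factor as \<open>w\<close> and
  ends with one of the same factor as \<open>w\<close> (\<open>centralizer_shift_oriented\<close>). So \<open>v w\<close> and \<open>w v\<close> are
  computed without cancellation, and \<open>v\<close> and \<open>w\<close> commute as lists. The lists commuting with \<open>w\<close>
  are the powers of a single list \<open>z\<close> (\<open>commuting_lists_cyclic\<close>). Therefore \<open>y\<close> is an integral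
  power of \<open>z\<close>, the centralizer of \<open>w\<close> is infinite cyclic with generator \<open>z\<close>, and \<open>w = z^k\<close> with
  \<open>k > 0\<close> (\<open>oriented_centralizer_root\<close>). This property is invariant under conjugation. Since a
  root of \<open>x\<close> commutes with \<open>x\<close>, the exponent \<open>k\<close> is the largest one for which \<open>x\<close> has a root;
  the remaining claims are statements about the integers.
\<close>

section \<open>Conjugacy classes and cyclic centralizers in a group\<close>

lemma conj_class_hom:
  assumes "group \<Gamma>" "group \<Delta>" "f \<in> hom \<Gamma> \<Delta>" "x \<in> carrier \<Gamma>" "y \<in> conj_class \<Gamma> x"
  shows "f y \<in> conj_class \<Delta> (f x)"
proof -
  interpret f: group_hom \<Gamma> \<Delta> f
    using assms by (simp add: group_hom_def group_hom_axioms_def)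
  obtain g where "g \<in> carrier \<Gamma>" "y = g \<otimes>\<^bsub>\<Gamma>\<^esub> x \<otimes>\<^bsub>\<Gamma>\<^esub> inv\<^bsub>\<Gamma>\<^esub> g"
    using assms(5) by (auto simp: conj_class_def)
  then have "f y = f g \<otimes>\<^bsub>\<Delta>\<^esub> f x \<otimes>\<^bsub>\<Delta>\<^esub> inv\<^bsub>\<Delta>\<^esub> f g" "f g \<in> carrier \<Delta>"
    using assms(4) by simp_all
  then show ?thesis unfolding conj_class_def by blast
qed

context group
begin

lemma conj_class_closed: "x \<in> carrier G \<Longrightarrow> y \<in> conj_class G x \<Longrightarrow> y \<in> carrier G"
  by (auto simp: conj_class_def)

lemma conj_class_self:
  assumes "x \<in> carrier G" shows "x \<in> conj_class G x"
proof -
  have "x = \<one> \<otimes> x \<otimes> inv \<one>" using assms by simp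
  then show ?thesis unfolding conj_class_def by blast
qed

lemma conj_class_sym:
  assumes "x \<in> carrier G" "y \<in> conj_class G x"
  shows "x \<in> conj_class G y"
proof -
  obtain g where g: "g \<in> carrier G" "y = g \<otimes> x \<otimes> inv g"
    using assms by (auto simp: conj_class_def)
  then have "x = inv g \<otimes> y \<otimes> inv (inv g)"
    using assms(1) by (simp add: m_assoc inv_solve_left)
  then show ?thesis using g unfolding conj_class_def by blast
qed

lemma conj_class_trans:
  assumes "x \<in> carrier G" "y \<in> conj_class G x" "z \<in> conj_class G y"
  shows "z \<in> conj_class G x"
proof -
  obtain g h where g: "g \<in> carrier G" "y = g \<otimes> x \<otimes> inv g"
    and h: "h \<in> carrier G" "z = h \<otimes> y \<otimes> inv h"
    using assms by (auto simp: conj_class_def)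
  then have "z = (h \<otimes> g) \<otimes> x \<otimes> inv (h \<otimes> g)"
    using assms(1) by (simp add: m_assoc inv_mult_group)
  then show ?thesis using g h unfolding conj_class_def by blast
qed

lemma conj_class_eq:
  assumes "x \<in> carrier G" "y \<in> conj_class G x"
  shows "conj_class G y = conj_class G x"
  using assms conj_class_closed conj_class_sym conj_class_trans by blast

lemma conj_class_eq_iff:
  assumes "x \<in> carrier G" "y \<in> carrier G"
  shows "conj_class G y = conj_class G x \<longleftrightarrow> y \<in> conj_class G x"
  using assms conj_class_eq conj_class_self by blast

lemma conj_class_one: "conj_class G \<one> = {\<one>}"
  using conj_class_self[OF one_closed] by (auto simp: conj_class_def)

lemma inv_cancel:
  assumes "g \<in> carrier G" "a \<in> carrier G"
  shows "inv g \<otimes> (g \<otimes> a) = a" "g \<otimes> (inv g \<otimes> a) = a"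
  using assms by (simp_all add: m_assoc[symmetric])

lemma centralizer_conj:
  assumes g: "g \<in> carrier G" and w: "w \<in> carrier G" and y: "y \<in> carrier G"
  shows "g \<otimes> y \<otimes> inv g \<in> centralizer G (g \<otimes> w \<otimes> inv g) \<longleftrightarrow> y \<in> centralizer G w"
proof -
  have "(g \<otimes> y \<otimes> inv g) \<otimes> (g \<otimes> w \<otimes> inv g) = g \<otimes> (y \<otimes> w) \<otimes> inv g"
    "(g \<otimes> w \<otimes> inv g) \<otimes> (g \<otimes> y \<otimes> inv g) = g \<otimes> (w \<otimes> y) \<otimes> inv g"
    using assms by (simp_all add: m_assoc inv_cancel)
  then show ?thesis
    using assms by (simp add: centralizer_def)
qed

text \<open>The element \<open>x\<close> is the \<open>k\<close>-th power, with \<open>k > 0\<close>, of an element \<open>z\<close> of infinite order whose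
  powers form the centralizer of \<open>x\<close>. The exponent map then identifies the pair consisting of
  the centralizer and the subgroup generated by \<open>x\<close> with the integers and their multiples
  of \<open>k\<close>.\<close>

definition centralizer_root :: "'a \<Rightarrow> 'a \<Rightarrow> int \<Rightarrow> bool" where
  "centralizer_root x z k \<longleftrightarrow> z \<in> carrier G \<and> 0 < k \<and> x = z [^] k \<and>
     inj (\<lambda>i::int. z [^] i) \<and> centralizer G x = range (\<lambda>i::int. z [^] i)"

lemma centralizer_root_conj:
  assumes "centralizer_root w z k" and g: "g \<in> carrier G"
  shows "centralizer_root (g \<otimes> w \<otimes> inv g) (g \<otimes> z \<otimes> inv g) k"
proof -
  define c where "c y = g \<otimes> y \<otimes> inv g" for y
  have z: "z \<in> carrier G" and k: "0 < k" "w = z [^] k" and inj: "inj (\<lambda>i::int. z [^] i)"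
    and C: "centralizer G w = range (\<lambda>i::int. z [^] i)"
    using assms by (auto simp: centralizer_root_def)
  have w: "w \<in> carrier G" using z k by simp
  have "c \<in> hom G G"
  proof (rule homI)
    fix a b assume "a \<in> carrier G" "b \<in> carrier G"
    then show "c (a \<otimes> b) = c a \<otimes> c b"
      using g by (simp add: c_def m_assoc inv_cancel)
  qed (use g in \<open>simp add: c_def\<close>)
  then have pow: "c z [^] i = c (z [^] i)" for i :: int
    using hom_int_pow[of c G G z i] z is_group by simp
  have c_inj: "y = y'" if "c y = c y'" "y \<in> carrier G" "y' \<in> carrier G" for y y'
    using that g by (simp add: c_def)
  have "centralizer G (c w) = c ` centralizer G w"
  proof
    show "c ` centralizer G w \<subseteq> centralizer G (c w)"
      using centralizer_conj[OF g w] by (auto simp: c_def centralizer_def)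
    show "centralizer G (c w) \<subseteq> c ` centralizer G w"
    proof
      fix y assume y: "y \<in> centralizer G (c w)"
      then have yc: "y \<in> carrier G" by (simp add: centralizer_def)
      have "y = c (inv g \<otimes> y \<otimes> g)"
        using yc g by (simp add: c_def m_assoc inv_cancel)
      moreover have "inv g \<otimes> y \<otimes> g \<in> centralizer G w"
        using centralizer_conj[OF g w, of "inv g \<otimes> y \<otimes> g"] y yc g calculation
        by (simp add: c_def)
      ultimately show "y \<in> c ` centralizer G w" by blast
    qed
  qed
  then have "centralizer G (c w) = range (\<lambda>i::int. c z [^] i)"
    by (simp add: C pow image_image)
  moreover have "inj (\<lambda>i::int. c z [^] i)"
    using inj c_inj z by (simp add: pow inj_def)
  moreover have "c z \<in> carrier G" using z g by (simp add: c_def)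
  moreover have "c w = c z [^] k" by (simp only: pow k(2))
  ultimately show ?thesis
    using k by (simp add: centralizer_root_def c_def)
qed

lemma root_exponents_max:
  assumes "centralizer_root x z k"
  shows "k \<in> root_exponents G x" and "j \<in> root_exponents G x \<Longrightarrow> j \<le> k"
proof -
  have z: "z \<in> carrier G" and k: "0 < k" "x = z [^] k" and inj: "inj (\<lambda>i::int. z [^] i)"
    and C: "centralizer G x = range (\<lambda>i::int. z [^] i)"
    using assms by (auto simp: centralizer_root_def)
  show "k \<in> root_exponents G x" using z k by (auto simp: root_exponents_def)
  show "j \<le> k" if "j \<in> root_exponents G x"
  proof -
    obtain y where y: "y \<in> carrier G" "x = y [^] j"
      using \<open>j \<in> root_exponents G x\<close> unfolding root_exponents_def by blast
    have "y \<otimes> x = x \<otimes> y"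
      using y int_pow_mult[of y 1 j] int_pow_mult[of y j 1] by (simp add: add.commute int_pow_1)
    then have "y \<in> range (\<lambda>i::int. z [^] i)"
      using y(1) by (simp add: C[symmetric] centralizer_def)
    then obtain i :: int where i: "y = z [^] i" by blast
    then have "z [^] k = z [^] (i * j)" using k(2) y(2) z by (simp add: int_pow_pow)
    then have "k = i * j" using inj by (simp add: inj_def)
    then have "j dvd k" by simp
    then show "j \<le> k" using k(1) by (rule zdvd_imp_le)
  qed
qed

lemma max_root_exponent_eq:
  assumes "centralizer_root x z k"
  shows "max_root_exponent G x = k"
  unfolding max_root_exponent_def
  using root_exponents_max[OF assms] by (intro Greatest_equality)

lemma centralizer_pair_iso:
  assumes "centralizer_root x z k"
  shows "\<exists>f \<in> iso (centralizer_group G x) integer_group.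
           f ` generate G {x} = range (\<lambda>m. k * m) \<and>
           (\<forall>y \<in> centralizer G x. y \<in> generate G {x} \<longleftrightarrow> k dvd f y)"
proof -
  have z: "z \<in> carrier G" and k: "0 < k" "x = z [^] k" and inj: "inj (\<lambda>i::int. z [^] i)"
    and C: "centralizer G x = range (\<lambda>i::int. z [^] i)"
    using assms by (auto simp: centralizer_root_def)
  have x: "x \<in> carrier G" using z k by simp
  define f where "f = inv_into UNIV (\<lambda>i::int. z [^] i)"
  have f: "f (z [^] i) = i" for i :: int
    unfolding f_def using inj by (rule inv_into_f_f) simp
  have gen: "generate G {x} = range (\<lambda>m. z [^] (k * m))"
    using generate_pow[OF x] z by (auto simp: k int_pow_pow)
  have "f \<in> iso (centralizer_group G x) integer_group"
  proof (rule isoI)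
    show "f \<in> hom (centralizer_group G x) integer_group"
    proof (rule homI)
      fix a b assume "a \<in> carrier (centralizer_group G x)" "b \<in> carrier (centralizer_group G x)"
      then obtain i j :: int where ij: "a = z [^] i" "b = z [^] j"
        by (auto simp: centralizer_group_def C)
      then have "a \<otimes> b = z [^] (i + j)" using z by (simp add: int_pow_mult)
      then show "f (a \<otimes>\<^bsub>centralizer_group G x\<^esub> b) = f a \<otimes>\<^bsub>integer_group\<^esub> f b"
        by (simp add: ij f centralizer_group_def)
    qed simp
    show "bij_betw f (carrier (centralizer_group G x)) (carrier integer_group)"
    proof (rule bij_betw_byWitness)
      show "(\<lambda>i::int. z [^] i) ` carrier integer_group \<subseteq> carrier (centralizer_group G x)"
        by (auto simp: centralizer_group_def C)
    qed (auto simp: centralizer_group_def C f)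
  qed
  moreover have "f ` generate G {x} = range (\<lambda>m. k * m)"
    by (simp add: gen image_image f)
  moreover have "y \<in> generate G {x} \<longleftrightarrow> k dvd f y" if "y \<in> centralizer G x" for y
  proof -
    obtain i :: int where i: "y = z [^] i" using \<open>y \<in> centralizer G x\<close> by (auto simp: C)
    have "z [^] i \<in> generate G {x} \<longleftrightarrow> k dvd i"
      using inj by (auto simp: gen dvd_def inj_def)
    then show ?thesis by (simp add: i f)
  qed
  ultimately show ?thesis by blast
qed

text \<open>The exponent map followed by reduction modulo \<open>k\<close> is onto, and its kernel is generated by \<open>x\<close>.\<close>

lemma reduced_centralizer_iso:
  assumes root: "centralizer_root x z k"
  shows "reduced_centralizer G x \<cong> integer_mod_group (nat k)"
proof -
  have z: "z \<in> carrier G" and k: "0 < k"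
    and C: "centralizer G x = range (\<lambda>i::int. z [^] i)"
    using root by (auto simp: centralizer_root_def)
  obtain f where f: "f \<in> iso (centralizer_group G x) integer_group"
    and ker: "\<forall>y \<in> centralizer G x. y \<in> generate G {x} \<longleftrightarrow> k dvd f y"
    using centralizer_pair_iso[OF root] by blast
  have carr: "carrier (centralizer_group G x) = centralizer G x"
    by (simp add: centralizer_group_def)
  have "centralizer G x = generate G {z}"
    using generate_pow[OF z] by (auto simp: C)
  then have "subgroup (centralizer G x) G"
    using generate_is_subgroup[of "{z}"] z by simp
  then have grp: "group (centralizer_group G x)"
    unfolding centralizer_group_def by (rule subgroup.subgroup_is_group) (rule is_group)
  have surj: "f ` centralizer G x = UNIV"
    using f by (auto simp: iso_def bij_betw_def carr)
  have mult: "f (a \<otimes>\<^bsub>centralizer_group G x\<^esub> b) = f a + f b"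
    if "a \<in> centralizer G x" "b \<in> centralizer G x" for a b
    using f that by (simp add: iso_def hom_def carr)
  define h where "h y = f y mod k" for y
  have kn: "int (nat k) = k" using k by simp
  have zm: "carrier (integer_mod_group (nat k)) = {0..<k}"
    using k by (simp add: carrier_integer_mod_group)
  have "h \<in> hom (centralizer_group G x) (integer_mod_group (nat k))"
    by (rule homI) (use k in \<open>simp_all add: zm carr mult h_def kn mod_add_eq\<close>)
  then interpret h: group_hom "centralizer_group G x" "integer_mod_group (nat k)" h
    using grp by (simp add: group_hom_def group_hom_axioms_def)
  have "h ` carrier (centralizer_group G x) = {0..<k}"
  proof -
    have "h ` centralizer G x = (\<lambda>i. i mod k) ` f ` centralizer G x"
      by (simp add: h_def image_image)
    also have "\<dots> = range (\<lambda>i. i mod k)" by (simp only: surj)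
    also have "\<dots> = {0..<k}"
    proof
      show "{0..<k} \<subseteq> range (\<lambda>i. i mod k)"
        by (metis atLeastLessThan_iff mod_pos_pos_trivial rangeI subsetI)
    qed (use k in auto)
    finally show ?thesis by (simp add: carr)
  qed
  then have "centralizer_group G x Mod kernel (centralizer_group G x) (integer_mod_group (nat k)) h
      \<cong> integer_mod_group (nat k)"
    using zm by (intro h.FactGroup_iso) simp
  moreover have "kernel (centralizer_group G x) (integer_mod_group (nat k)) h = generate G {x}"
  proof -
    have "x \<in> centralizer G x"
      using root by (simp add: centralizer_root_def centralizer_def)
    then have "generate G {x} \<subseteq> centralizer G x"
      using \<open>subgroup (centralizer G x) G\<close> by (intro generate_subgroup_incl) auto
    then show ?thesis
      using ker by (auto simp: kernel_def carr h_def dvd_eq_mod_eq_0)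
  qed
  ultimately show ?thesis by (simp add: reduced_centralizer_def)
qed

end


section \<open>Commuting lists\<close>

lemma commuting_list_replicate:
  "u @ w = w @ u \<Longrightarrow> u @ concat (replicate n w) = concat (replicate n w) @ u"
  by (induction n) (simp_all, metis append_assoc)

text \<open>Both lists are prefixes of a sufficiently high power of \<open>w\<close>, so the shorter one is a prefix of
  the longer one.\<close>

lemma commuting_list_prefix:
  assumes "u @ w = w @ u" "v @ w = w @ v" "w \<noteq> []" "length u \<le> length v"
  shows "\<exists>t. v = u @ t"
proof -
  define W where "W = concat (replicate (length v) w)"
  have "length v * 1 \<le> length v * length w"
    using assms(3) by (intro mult_le_mono2) (simp add: Suc_le_eq)
  then have W: "length v \<le> length W"
    by (simp add: W_def length_concat sum_list_replicate)
  have "u @ W = W @ u" "v @ W = W @ v"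
    using assms commuting_list_replicate unfolding W_def by blast+
  then have "u = take (length u) W" "v = take (length v) W"
    using W assms(4) by (metis append_eq_append_conv_if le_trans append_eq_conv_conj)+
  then have "u = take (length u) v"
    using assms(4) by (metis min.absorb1 take_take)
  then show ?thesis by (metis append_take_drop_id)
qed

text \<open>The generator is the shortest nonempty list that commutes with \<open>w\<close>: it is a prefix of every
  other such list, and what remains after removing it still commutes with \<open>w\<close>.\<close>

lemma commuting_lists_cyclic:
  assumes w: "w \<noteq> []"
  obtains z where "z \<noteq> []" "\<And>v. v @ w = w @ v \<Longrightarrow> \<exists>n. v = concat (replicate n z)"
proof -
  obtain z where z: "z \<noteq> []" "z @ w = w @ z"
    and least: "\<And>v. v \<noteq> [] \<Longrightarrow> v @ w = w @ v \<Longrightarrow> length z \<le> length v"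
    using ex_has_least_nat[of "\<lambda>z. z \<noteq> [] \<and> z @ w = w @ z" w length] w by blast
  have "\<exists>n. v = concat (replicate n z)" if "v @ w = w @ v" for v
    using that
  proof (induction "length v" arbitrary: v rule: less_induct)
    case less
    show ?case
    proof (cases "v = []")
      case False
      obtain t where t: "v = z @ t"
        using commuting_list_prefix[OF z(2) less.prems w least] False less.prems by blast
      have "z @ t @ w = w @ z @ t" using less.prems t by simp
      also have "\<dots> = z @ w @ t" using z(2) by (metis append_assoc)
      finally have "t @ w = w @ t" by simp
      moreover have "length t < length v" using t z(1) by simp
      ultimately obtain n where "t = concat (replicate n z)" using less.hyps by blast
      then have "v = concat (replicate (Suc n) z)" by (simp add: t)
      then show ?thesis by blast
    qed (rule exI[of _ 0], simp)
  qed
  then show ?thesis using that z(1) by blast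
qed


section \<open>Reduced words\<close>

locale free_factors = H: group H + G: group G
  for H :: "('a, 'm) monoid_scheme" and G :: "('b, 'n) monoid_scheme"
begin

sublocale P: group "free_product H G"
  by (rule group_free_product) unfold_locales

lemma carrier_P: "carrier (free_product H G) = reduced_words H G"
  and one_P: "\<one>\<^bsub>free_product H G\<^esub> = []"
  and mult_P: "u \<otimes>\<^bsub>free_product H G\<^esub> v = foldr (fp_cons H G) u v"
  by (simp_all add: free_product_def)

lemma reduced_append:
  "u @ v \<in> reduced_words H G \<longleftrightarrow> u \<in> reduced_words H G \<and> v \<in> reduced_words H G \<and>
     (u = [] \<or> v = [] \<or> isl (last u) \<noteq> isl (hd v))"
  by (auto simp: reduced_words_def successively_append_iff)

lemma foldr_eq_append: "u @ v \<in> reduced_words H G \<Longrightarrow> foldr (fp_cons H G) u v = u @ v"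
proof (induction u)
  case (Cons a u)
  then have "u @ v \<in> reduced_words H G"
    using reduced_ConsD[OF H.is_group G.is_group] by simp
  then show ?case using Cons fp_cons_Cons[OF H.is_group G.is_group, of a "u @ v"] by simp
qed simp

lemma length_fp_cons:
  "length (fp_cons H G a w) \<le> Suc (length w)" "length w \<le> Suc (length (fp_cons H G a w))"
  by (cases "(H, G, a, w)" rule: fp_cons.cases; simp)+

lemma length_mult_le: "length (foldr (fp_cons H G) u v) \<le> length u + length v"
  using le_trans[OF length_fp_cons(1)] by (induction u) auto

lemma last_fp_cons: "2 \<le> length w \<Longrightarrow> last (fp_cons H G a w) = last w"
  by (cases "(H, G, a, w)" rule: fp_cons.cases) auto

text \<open>Each letter of \<open>u\<close> removes at most one letter of \<open>v\<close>, so the last letter of \<open>v\<close> is not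
  reached.\<close>

lemma last_mult_longer:
  assumes "length u < length v"
  shows "last (foldr (fp_cons H G) u v) = last v \<and>
         length v \<le> length u + length (foldr (fp_cons H G) u v)"
  using assms
proof (induction u)
  case (Cons a u)
  then have "2 \<le> length (foldr (fp_cons H G) u v)" by simp
  then show ?case
    using Cons last_fp_cons[of "foldr (fp_cons H G) u v" a]
      length_fp_cons(2)[of "foldr (fp_cons H G) u v" a] by simp
qed simp

text \<open>The inverse of a letter in its own factor.\<close>

definition inv_letter :: "'a + 'b \<Rightarrow> 'a + 'b" where
  "inv_letter = map_sum (\<lambda>h. inv\<^bsub>H\<^esub> h) (\<lambda>g. inv\<^bsub>G\<^esub> g)"

lemma isl_inv_letter [simp]: "isl (inv_letter a) = isl a"
  by (cases a) (simp_all add: inv_letter_def)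

lemma inv_P:
  assumes "w \<in> reduced_words H G"
  shows "inv\<^bsub>free_product H G\<^esub> w = rev (map inv_letter w)"
proof (rule P.inv_equality)
  have letter: "inv_letter a \<in> fp_letters H G" if "a \<in> fp_letters H G" for a
    using that by (auto simp: inv_letter_def fp_letters_def)
  have cancel: "fp_cons H G (inv_letter a) (a # v) = v" if "a \<in> fp_letters H G" for a v
    using that by (cases a) (auto simp: inv_letter_def fp_letters_def)
  have "successively (\<lambda>a b. isl b \<noteq> isl a) w"
    using assms by (auto simp: reduced_words_def elim: successively_mono)
  then show "rev (map inv_letter w) \<in> carrier (free_product H G)"
    using assms letter by (auto simp: carrier_P reduced_words_def successively_map)
  have "set w \<subseteq> fp_letters H G" using assms by (simp add: reduced_words_def)
  then have "foldr (fp_cons H G) (rev (map inv_letter w)) w = []"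
    by (induction w) (simp_all add: cancel)
  then show "rev (map inv_letter w) \<otimes>\<^bsub>free_product H G\<^esub> w = \<one>\<^bsub>free_product H G\<^esub>"
    by (simp add: mult_P one_P)
  show "w \<in> carrier (free_product H G)" using assms by (simp add: carrier_P)
qed


section \<open>Classes and centralizers of elements of the factors\<close>

lemma retraction_H:
  obtains r where "r \<in> hom (free_product H G) H"
    "\<And>h. h \<in> carrier H \<Longrightarrow> r (fp_inl H h) = h" "\<And>g. g \<in> carrier G \<Longrightarrow> r (fp_inr G g) = \<one>\<^bsub>H\<^esub>"
proof -
  have "(\<lambda>h. h) \<in> hom H H" "(\<lambda>_. \<one>\<^bsub>H\<^esub>) \<in> hom G H" by (auto simp: hom_def)
  then show ?thesis
    using free_product_universal[OF H.is_group G.is_group H.is_group] that by blast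
qed

lemma retraction_G:
  obtains r where "r \<in> hom (free_product H G) G"
    "\<And>g. g \<in> carrier G \<Longrightarrow> r (fp_inr G g) = g" "\<And>h. h \<in> carrier H \<Longrightarrow> r (fp_inl H h) = \<one>\<^bsub>G\<^esub>"
proof -
  have "(\<lambda>g. g) \<in> hom G G" "(\<lambda>_. \<one>\<^bsub>G\<^esub>) \<in> hom H G" by (auto simp: hom_def)
  then show ?thesis
    using free_product_universal[OF H.is_group G.is_group G.is_group] that by blast
qed

lemma fp_inl_closed: "h \<in> carrier H \<Longrightarrow> fp_inl H h \<in> carrier (free_product H G)"
  using fp_inl_hom[OF H.is_group G.is_group] by (rule hom_in_carrier)

lemma fp_inr_closed: "g \<in> carrier G \<Longrightarrow> fp_inr G g \<in> carrier (free_product H G)"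
  using fp_inr_hom[OF H.is_group G.is_group] by (rule hom_in_carrier)

lemma conj_class_inl_iff:
  assumes "h \<in> carrier H" "h' \<in> carrier H"
  shows "conj_class (free_product H G) (fp_inl H h) = conj_class (free_product H G) (fp_inl H h')
    \<longleftrightarrow> conj_class H h = conj_class H h'"
proof -
  obtain r where r: "r \<in> hom (free_product H G) H" "\<And>h. h \<in> carrier H \<Longrightarrow> r (fp_inl H h) = h"
    using retraction_H by blast
  show ?thesis
    using conj_class_hom[OF P.is_group H.is_group r(1), of "fp_inl H h'" "fp_inl H h"]
      conj_class_hom[OF H.is_group P.is_group fp_inl_hom[OF H.is_group G.is_group], of h' h] r(2) assms
    by (auto simp: P.conj_class_eq_iff H.conj_class_eq_iff fp_inl_closed)
qed

lemma conj_class_inr_iff: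
  assumes "g \<in> carrier G" "g' \<in> carrier G"
  shows "conj_class (free_product H G) (fp_inr G g) = conj_class (free_product H G) (fp_inr G g')
    \<longleftrightarrow> conj_class G g = conj_class G g'"
proof -
  obtain r where r: "r \<in> hom (free_product H G) G" "\<And>g. g \<in> carrier G \<Longrightarrow> r (fp_inr G g) = g"
    using retraction_G by blast
  show ?thesis
    using conj_class_hom[OF P.is_group G.is_group r(1), of "fp_inr G g'" "fp_inr G g"]
      conj_class_hom[OF G.is_group P.is_group fp_inr_hom[OF H.is_group G.is_group], of g' g] r(2) assms
    by (auto simp: P.conj_class_eq_iff G.conj_class_eq_iff fp_inr_closed)
qed

lemma conj_class_inl_inr:
  assumes "h \<in> carrier H" "g \<in> carrier G"
    "conj_class (free_product H G) (fp_inl H h) = conj_class (free_product H G) (fp_inr G g)"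
  shows "h = \<one>\<^bsub>H\<^esub>"
proof -
  obtain r where r: "r \<in> hom (free_product H G) H" "\<And>h. h \<in> carrier H \<Longrightarrow> r (fp_inl H h) = h"
    "\<And>g. g \<in> carrier G \<Longrightarrow> r (fp_inr G g) = \<one>\<^bsub>H\<^esub>"
    using retraction_H by blast
  have "fp_inl H h \<in> conj_class (free_product H G) (fp_inr G g)"
    using assms by (simp add: P.conj_class_eq_iff fp_inl_closed fp_inr_closed)
  then have "r (fp_inl H h) \<in> conj_class H (r (fp_inr G g))"
    using conj_class_hom[OF P.is_group H.is_group r(1)] assms(2) fp_inr_closed by blast
  then show ?thesis using r assms by (simp add: H.conj_class_one)
qed

text \<open>If \<open>y\<close> has at least two letters, then the reduced word of \<open>[a] y\<close> ends in the last letter of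
  \<open>y\<close>, but that of \<open>y [a]\<close> does not.\<close>

lemma centralizer_letter:
  assumes a: "a \<in> fp_letters H G" and y: "y \<in> centralizer (free_product H G) [a]"
  shows "y = [] \<or> (\<exists>b. y = [b] \<and> isl b = isl a)"
proof (cases y rule: rev_cases)
  case (snoc u b)
  have yW: "y \<in> reduced_words H G" and eq: "foldr (fp_cons H G) y [a] = fp_cons H G a y"
    using y by (simp_all add: centralizer_def carrier_P mult_P)
  have u: "u \<in> reduced_words H G" "b \<in> fp_letters H G" "u = [] \<or> isl (last u) \<noteq> isl b"
    using yW reduced_append[of u "[b]"] by (simp_all add: snoc reduced_words_def)
  show ?thesis
  proof (cases "isl b = isl a")
    case False
    have "y @ [a] \<in> reduced_words H G"
      using yW a False by (simp add: reduced_append snoc) (simp add: reduced_words_def)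
    then have 1: "fp_cons H G a y = y @ [a]" using eq by (simp add: foldr_eq_append)
    have "last (fp_cons H G a y) = last y"
    proof (cases "u = []")
      case True
      then show ?thesis using False by (cases a; cases b) (simp_all add: snoc)
    next
      case u: False
      then show ?thesis by (intro last_fp_cons) (simp add: snoc Suc_le_eq)
    qed
    then show ?thesis using False 1 by (simp add: snoc)
  next
    case True
    have "u = []"
    proof (rule ccontr)
      assume "u \<noteq> []"
      then have "last (fp_cons H G a y) = last y"
        by (intro last_fp_cons) (simp add: snoc Suc_le_eq)
      then have 1: "last (foldr (fp_cons H G) u (fp_cons H G b [a])) = b"
        using eq by (simp add: snoc)
      \<comment> \<open>The product of \<open>b\<close> and \<open>a\<close> in their common factor differs from \<open>b\<close>, since \<open>a\<close> is
        nontrivial.\<close>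
      have "fp_cons H G b [a] = [] \<or>
          (\<exists>c. fp_cons H G b [a] = [c] \<and> c \<in> fp_letters H G \<and> isl c = isl b \<and> c \<noteq> b)"
        using True a u(2) by (cases a; cases b) (auto simp: fp_letters_def)
      then consider "fp_cons H G b [a] = []"
        | c where "fp_cons H G b [a] = [c]" "c \<in> fp_letters H G" "isl c = isl b" "c \<noteq> b"
        by blast
      then show False
      proof cases
        case 1
        then have "last u = b"
          using \<open>last (foldr _ _ _) = b\<close> u(1) foldr_eq_append[of u "[]"] by simp
        then show False using u(3) \<open>u \<noteq> []\<close> by simp
      next
        case (2 c)
        then have "u @ [c] \<in> reduced_words H G"
          using u by (auto simp: reduced_append) (simp_all add: reduced_words_def)
        then show False using 1 2 by (simp add: foldr_eq_append)
      qed
    qed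
    then show ?thesis using True snoc by simp
  qed
qed simp

lemma centralizer_inr:
  assumes x: "x \<in> carrier G" "x \<noteq> \<one>\<^bsub>G\<^esub>"
  shows "centralizer (free_product H G) (fp_inr G x) = fp_inr G ` centralizer G x"
proof
  note hom = fp_inr_hom[OF H.is_group G.is_group]
  show "fp_inr G ` centralizer G x \<subseteq> centralizer (free_product H G) (fp_inr G x)"
    using x hom_mult[OF hom, symmetric] fp_inr_closed by (auto simp: centralizer_def)
  show "centralizer (free_product H G) (fp_inr G x) \<subseteq> fp_inr G ` centralizer G x"
  proof
    fix y assume y: "y \<in> centralizer (free_product H G) (fp_inr G x)"
    then have "y = [] \<or> (\<exists>b. y = [b] \<and> isl b = isl (Inr x :: 'a + 'b))"
      using centralizer_letter[of "Inr x" y] x by (auto simp: fp_inr_def fp_letters_def)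
    moreover have "set y \<subseteq> fp_letters H G"
      using y by (auto simp: centralizer_def carrier_P reduced_words_def)
    ultimately obtain g where g: "g \<in> carrier G" "y = fp_inr G g"
    proof (elim disjE exE conjE)
      assume "y = []" then show thesis using that[of "\<one>\<^bsub>G\<^esub>"] by (simp add: fp_inr_def)
    next
      fix b assume b: "y = [b]" "isl b = isl (Inr x :: 'a + 'b)" "set y \<subseteq> fp_letters H G"
      then obtain g where "b = Inr g" by (cases b) auto
      moreover from this have "g \<in> carrier G" "g \<noteq> \<one>\<^bsub>G\<^esub>" using b by (auto simp: fp_letters_def)
      ultimately show thesis using b that[of g] by (simp add: fp_inr_def)
    qed
    then have "fp_inr G (g \<otimes>\<^bsub>G\<^esub> x) = (fp_inr G (x \<otimes>\<^bsub>G\<^esub> g) :: ('a + 'b) list)"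
      using y x hom_mult[OF hom] by (simp add: centralizer_def)
    then have "g \<otimes>\<^bsub>G\<^esub> x = x \<otimes>\<^bsub>G\<^esub> g"
      by (rule injD[OF inj_fp_inr[OF H.is_group G.is_group]])
    then show "y \<in> fp_inr G ` centralizer G x" using g by (auto simp: centralizer_def)
  qed
qed

lemma centralizer_inl:
  assumes x: "x \<in> carrier H" "x \<noteq> \<one>\<^bsub>H\<^esub>"
  shows "centralizer (free_product H G) (fp_inl H x) = fp_inl H ` centralizer H x"
proof
  note hom = fp_inl_hom[OF H.is_group G.is_group]
  show "fp_inl H ` centralizer H x \<subseteq> centralizer (free_product H G) (fp_inl H x)"
    using x hom_mult[OF hom, symmetric] fp_inl_closed by (auto simp: centralizer_def)
  show "centralizer (free_product H G) (fp_inl H x) \<subseteq> fp_inl H ` centralizer H x"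
  proof
    fix y assume y: "y \<in> centralizer (free_product H G) (fp_inl H x)"
    then have "y = [] \<or> (\<exists>b. y = [b] \<and> isl b = isl (Inl x :: 'a + 'b))"
      using centralizer_letter[of "Inl x" y] x by (auto simp: fp_inl_def fp_letters_def)
    moreover have "set y \<subseteq> fp_letters H G"
      using y by (auto simp: centralizer_def carrier_P reduced_words_def)
    ultimately obtain h where h: "h \<in> carrier H" "y = fp_inl H h"
    proof (elim disjE exE conjE)
      assume "y = []" then show thesis using that[of "\<one>\<^bsub>H\<^esub>"] by (simp add: fp_inl_def)
    next
      fix b assume b: "y = [b]" "isl b = isl (Inl x :: 'a + 'b)" "set y \<subseteq> fp_letters H G"
      then obtain h where "b = Inl h" by (cases b) auto
      moreover from this have "h \<in> carrier H" "h \<noteq> \<one>\<^bsub>H\<^esub>" using b by (auto simp: fp_letters_def)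
      ultimately show thesis using b that[of h] by (simp add: fp_inl_def)
    qed
    then have "fp_inl H (h \<otimes>\<^bsub>H\<^esub> x) = (fp_inl H (x \<otimes>\<^bsub>H\<^esub> h) :: ('a + 'b) list)"
      using y x hom_mult[OF hom] by (simp add: centralizer_def)
    then have "h \<otimes>\<^bsub>H\<^esub> x = x \<otimes>\<^bsub>H\<^esub> h"
      by (rule injD[OF inj_fp_inl[OF H.is_group G.is_group]])
    then show "y \<in> fp_inl H ` centralizer H x" using h by (auto simp: centralizer_def)
  qed
qed


section \<open>Cyclically reduced words\<close>

text \<open>Reduced words that begin with a letter of one prescribed factor (\<open>H\<close> if \<open>s\<close> is true, else \<open>G\<close>)
  and end with a letter of the other one, together with the empty word. Among these words the
  product of the free product is concatenation.\<close>

definition oriented :: "bool \<Rightarrow> ('a + 'b) list set" where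
  "oriented s = {w \<in> reduced_words H G. w \<noteq> [] \<longrightarrow> isl (hd w) = s \<and> isl (last w) \<noteq> s}"

lemma oriented_closed: "w \<in> oriented s \<Longrightarrow> w \<in> carrier (free_product H G)"
  by (simp add: oriented_def carrier_P)

lemma oriented_append: "u \<in> oriented s \<Longrightarrow> v \<in> oriented s \<Longrightarrow> u @ v \<in> oriented s"
  by (cases "u = []"; cases "v = []") (auto simp: oriented_def reduced_append)

lemma oriented_mult:
  "u \<in> oriented s \<Longrightarrow> v \<in> oriented s \<Longrightarrow> u \<otimes>\<^bsub>free_product H G\<^esub> v = u @ v"
  using oriented_append[of u s v] by (simp add: mult_P oriented_def foldr_eq_append)

lemma oriented_pow:
  assumes "w \<in> oriented s"
  shows "w [^]\<^bsub>free_product H G\<^esub> n = concat (replicate n w) \<and> concat (replicate n w) \<in> oriented s"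
proof (induction n)
  case 0
  show ?case by (simp add: one_P oriented_def Nil_reduced[OF H.is_group G.is_group])
next
  case (Suc n)
  then have "w [^]\<^bsub>free_product H G\<^esub> Suc n = concat (replicate n w) @ w"
    using assms by (simp add: oriented_mult[of _ s])
  also have "\<dots> = concat (replicate (Suc n) w)"
    using commuting_list_replicate[of w w n] by simp
  finally show ?case using Suc assms oriented_append[of w s "concat (replicate n w)"] by simp
qed

text \<open>A shortest element of a class is such a word unless it is a single letter: a word of at least
  two letters with both end letters in the same factor becomes shorter when its first letter is
  moved to the end.\<close>

lemma conj_class_oriented:
  assumes x: "x \<in> carrier (free_product H G)"
  obtains v where "v \<in> conj_class (free_product H G) x" "length v \<le> 1 \<or> (\<exists>s. v \<in> oriented s)"
proof -
  obtain v where v: "v \<in> conj_class (free_product H G) x"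
    and least: "\<And>u. u \<in> conj_class (free_product H G) x \<Longrightarrow> length v \<le> length u"
    using ex_has_least_nat[of "\<lambda>v. v \<in> conj_class (free_product H G) x" x length]
      P.conj_class_self[OF x] by blast
  have vP: "v \<in> carrier (free_product H G)" using P.conj_class_closed[OF x v] .
  have "length v \<le> 1 \<or> (\<exists>s. v \<in> oriented s)"
  proof (rule ccontr)
    assume "\<not> ?thesis"
    then have long: "1 < length v" and same: "isl (hd v) = isl (last v)"
      using vP by (auto simp: oriented_def carrier_P)
    obtain a t where at: "v = a # t" using long by (cases v) auto
    obtain m b where mb: "t = m @ [b]" using long at by (cases t rule: rev_cases) auto
    have red: "[a] @ t \<in> reduced_words H G" using vP at by (simp add: carrier_P)
    then have aP: "[a] \<in> carrier (free_product H G)" and tP: "t \<in> carrier (free_product H G)"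
      unfolding reduced_append by (simp_all add: carrier_P)
    have veq: "v = [a] \<otimes>\<^bsub>free_product H G\<^esub> t"
      using red foldr_eq_append[OF red] by (simp only: at mult_P append_Cons append_Nil)
    \<comment> \<open>Conjugating \<open>v = a t\<close> to \<open>t a\<close> lets \<open>a\<close> merge with the last letter of \<open>t\<close>.\<close>
    let ?u = "t \<otimes>\<^bsub>free_product H G\<^esub> [a]"
    let ?i = "inv\<^bsub>free_product H G\<^esub> [a]"
    have "?u = ?i \<otimes>\<^bsub>free_product H G\<^esub> v \<otimes>\<^bsub>free_product H G\<^esub> inv\<^bsub>free_product H G\<^esub> ?i"
      using aP tP by (simp add: veq P.m_assoc P.inv_solve_left)
    then have "?u \<in> conj_class (free_product H G) v"
      using P.inv_closed[OF aP] unfolding conj_class_def by blast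
    then have "?u \<in> conj_class (free_product H G) x"
      using P.conj_class_trans[OF x v] by blast
    then have "length v \<le> length ?u" by (rule least)
    moreover have "length (fp_cons H G b [a]) \<le> 1"
      using same by (cases a; cases b) (simp_all add: at mb)
    then have "length ?u < length v"
      using length_mult_le[of m "fp_cons H G b [a]"] by (simp add: mult_P at mb)
    ultimately show False by simp
  qed
  then show thesis using that v by blast
qed

text \<open>Once \<open>n\<close> exceeds the length of \<open>y\<close>, multiplication by \<open>y\<close> from the left does not reach the
  last letter of the \<open>n\<close>-th power of \<open>w\<close>, and multiplication from the right does not reach its
  first letter.\<close>

lemma centralizer_shift_oriented:
  assumes w: "w \<in> oriented s" "w \<noteq> []" and y: "y \<in> centralizer (free_product H G) w"
  shows "\<exists>n::nat. y \<otimes>\<^bsub>free_product H G\<^esub> w [^]\<^bsub>free_product H G\<^esub> n \<in> oriented s"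
proof -
  define n where "n = Suc (length y)"
  define p where "p = w [^]\<^bsub>free_product H G\<^esub> n"
  define v where "v = y \<otimes>\<^bsub>free_product H G\<^esub> p"
  have wP: "w \<in> carrier (free_product H G)" using w(1) by (rule oriented_closed)
  have yP: "y \<in> carrier (free_product H G)" and comm: "y \<otimes>\<^bsub>free_product H G\<^esub> w = w \<otimes>\<^bsub>free_product H G\<^esub> y"
    using y by (simp_all add: centralizer_def)
  have pO: "p \<in> oriented s" and "length p = n * length w"
    using oriented_pow[OF w(1), of n] by (simp_all add: p_def length_concat sum_list_replicate)
  then have len: "length y < length p" using w(2) by (cases w) (auto simp: n_def)
  have p: "p \<noteq> []" "isl (hd p) = s" "isl (last p) \<noteq> s" "p \<in> carrier (free_product H G)"
    using len pO oriented_closed[OF pO] by (auto simp: oriented_def)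
  have vP: "v \<in> carrier (free_product H G)" using yP p by (simp add: v_def)
  have last: "last v = last p" and v: "v \<noteq> []"
    using last_mult_longer[OF len] len by (auto simp: v_def mult_P)
  \<comment> \<open>The first letter of \<open>v\<close> is read off from the last letter of its inverse.\<close>
  have last_inv: "isl (last (inv\<^bsub>free_product H G\<^esub> u)) = isl (hd u)"
    if "u \<in> carrier (free_product H G)" "u \<noteq> []" for u
    using that by (simp add: carrier_P inv_P last_rev hd_map)
  have len_inv: "length (inv\<^bsub>free_product H G\<^esub> u) = length u"
    if "u \<in> carrier (free_product H G)" for u
    using that by (simp add: carrier_P inv_P)
  have "v = p \<otimes>\<^bsub>free_product H G\<^esub> y"
    unfolding v_def p_def
  proof (induction n)
    case (Suc n)
    then show ?case using comm wP yP by simp (metis P.m_assoc P.nat_pow_closed)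
  qed (use yP in simp)
  then have "inv\<^bsub>free_product H G\<^esub> v = inv\<^bsub>free_product H G\<^esub> y \<otimes>\<^bsub>free_product H G\<^esub> inv\<^bsub>free_product H G\<^esub> p"
    using yP p by (simp add: P.inv_mult_group)
  then have "last (inv\<^bsub>free_product H G\<^esub> v) = last (inv\<^bsub>free_product H G\<^esub> p)"
    using last_mult_longer[of "inv\<^bsub>free_product H G\<^esub> y" "inv\<^bsub>free_product H G\<^esub> p"] len yP p
    by (simp add: mult_P len_inv)
  then have "isl (hd v) = isl (hd p)"
    using last_inv[OF vP v] last_inv[OF p(4,1)] by simp
  then have "v \<in> oriented s"
    using vP last p by (simp add: oriented_def carrier_P)
  then show ?thesis unfolding v_def p_def by blast
qed

text \<open>The generator of the centralizer is the list \<open>z\<close> whose powers are the lists that commute with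
  \<open>w\<close>. It is a prefix and a suffix of \<open>w\<close>, hence its powers in the free product are its powers
  as a list.\<close>

lemma oriented_centralizer_root:
  assumes w: "w \<in> oriented s" "w \<noteq> []"
  shows "\<exists>z k. P.centralizer_root w z k"
proof -
  obtain z where z: "z \<noteq> []" and pow: "\<And>v. v @ w = w @ v \<Longrightarrow> \<exists>n. v = concat (replicate n z)"
    using commuting_lists_cyclic[OF w(2)] by blast
  obtain k where k: "w = concat (replicate k z)" using pow[of w] by blast
  then have k0: "k > 0" using w(2) by (cases k) auto
  have wP: "w \<in> carrier (free_product H G)" using w(1) by (rule oriented_closed)
  have zO: "z \<in> oriented s"
  proof -
    obtain j where j: "k = Suc j" using k0 by (cases k) auto
    have 1: "w = z @ concat (replicate j z)" by (simp add: k j)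
    then have 2: "w = concat (replicate j z) @ z"
      using commuting_list_replicate[of z z j] by simp
    have "hd w = hd z" using z by (simp add: 1)
    moreover have "last w = last z" using z by (simp add: 2)
    moreover have "z \<in> reduced_words H G"
      using w(1) reduced_append[of z "concat (replicate j z)"] by (simp add: oriented_def flip: 1)
    ultimately
    show ?thesis using w z by (simp add: oriented_def)
  qed
  have zP: "z \<in> carrier (free_product H G)" using zO by (rule oriented_closed)
  have zpow: "z [^]\<^bsub>free_product H G\<^esub> n = concat (replicate n z)" for n :: nat
    using oriented_pow[OF zO] by blast
  have wk: "w = z [^]\<^bsub>free_product H G\<^esub> int k"
    by (simp add: int_pow_int zpow k)
  have "P.ord z = 0"
    using z by (auto simp: P.ord_eq_0[OF zP] zpow one_P)
  then have inj: "inj (\<lambda>i::int. z [^]\<^bsub>free_product H G\<^esub> i)"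
    using zP by (simp add: inj_def P.int_pow_eq)
  have "centralizer (free_product H G) w = range (\<lambda>i::int. z [^]\<^bsub>free_product H G\<^esub> i)"
  proof
    show "range (\<lambda>i::int. z [^]\<^bsub>free_product H G\<^esub> i) \<subseteq> centralizer (free_product H G) w"
      using zP by (auto simp: centralizer_def wk P.int_pow_mult[symmetric] add.commute)
    show "centralizer (free_product H G) w \<subseteq> range (\<lambda>i::int. z [^]\<^bsub>free_product H G\<^esub> i)"
    proof
      fix y assume y: "y \<in> centralizer (free_product H G) w"
      then have yP: "y \<in> carrier (free_product H G)"
        and comm: "y \<otimes>\<^bsub>free_product H G\<^esub> w = w \<otimes>\<^bsub>free_product H G\<^esub> y"
        by (simp_all add: centralizer_def)
      obtain n :: nat where n: "y \<otimes>\<^bsub>free_product H G\<^esub> w [^]\<^bsub>free_product H G\<^esub> n \<in> oriented s"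
        using centralizer_shift_oriented[OF w y] by blast
      define p where "p = w [^]\<^bsub>free_product H G\<^esub> n"
      have pP: "p \<in> carrier (free_product H G)" using wP by (simp add: p_def)
      have "p \<otimes>\<^bsub>free_product H G\<^esub> w = w \<otimes>\<^bsub>free_product H G\<^esub> p"
        using P.nat_pow_comm[of w n 1] wP by (simp add: p_def)
      then have "(y \<otimes>\<^bsub>free_product H G\<^esub> p) \<otimes>\<^bsub>free_product H G\<^esub> w =
          w \<otimes>\<^bsub>free_product H G\<^esub> (y \<otimes>\<^bsub>free_product H G\<^esub> p)"
        using yP pP wP comm by (metis P.m_assoc)
      then have "(y \<otimes>\<^bsub>free_product H G\<^esub> p) @ w = w @ (y \<otimes>\<^bsub>free_product H G\<^esub> p)"
        using n w by (simp add: oriented_mult p_def)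
      then obtain i where "y \<otimes>\<^bsub>free_product H G\<^esub> p = z [^]\<^bsub>free_product H G\<^esub> int i"
        using pow by (metis zpow int_pow_int)
      moreover have "p = z [^]\<^bsub>free_product H G\<^esub> (int k * int n)"
        using zP by (simp add: p_def wk P.int_pow_pow[symmetric] int_pow_int)
      ultimately have "y = z [^]\<^bsub>free_product H G\<^esub> (int i - int k * int n)"
        using yP zP by (simp add: P.int_pow_diff P.inv_solve_right)
      then show "y \<in> range (\<lambda>i::int. z [^]\<^bsub>free_product H G\<^esub> i)" by blast
    qed
  qed
  then have "P.centralizer_root w z (int k)"
    using zP k0 wk inj unfolding P.centralizer_root_def by simp
  then show ?thesis by blast
qed

lemma centralizer_root_exists:
  assumes x: "x \<in> carrier (free_product H G)"
    and "conj_class (free_product H G) x \<inter> fp_inr G ` carrier G = {}"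
    and "conj_class (free_product H G) x \<inter> fp_inl H ` carrier H = {}"
  shows "\<exists>z k. P.centralizer_root x z k"
proof -
  obtain v where v: "v \<in> conj_class (free_product H G) x" "length v \<le> 1 \<or> (\<exists>s. v \<in> oriented s)"
    using conj_class_oriented[OF x] by blast
  have vP: "v \<in> reduced_words H G" using P.conj_class_closed[OF x v(1)] by (simp add: carrier_P)
  have no: "v \<notin> fp_inr G ` carrier G" "v \<notin> fp_inl H ` carrier H" using assms v by auto
  have "\<not> length v \<le> 1"
  proof
    assume "length v \<le> 1"
    then consider "v = []" | a where "v = [a]" by (cases v) auto
    then show False
    proof cases
      case 1
      then have "v = fp_inl H \<one>\<^bsub>H\<^esub>" by (simp add: fp_inl_def)
      then show False using no(2) by blast
    next
      case (2 a)
      then have "a \<in> fp_letters H G" using vP by (simp add: reduced_words_def)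
      then show False
        using no 2 by (cases a) (auto simp: fp_letters_def fp_inl_def fp_inr_def image_def)
    qed
  qed
  then have "v \<noteq> []" by auto
  moreover obtain s where "v \<in> oriented s" using v(2) \<open>\<not> length v \<le> 1\<close> by blast
  ultimately obtain z k where "P.centralizer_root v z k" using oriented_centralizer_root by blast
  moreover obtain g where "g \<in> carrier (free_product H G)"
    "x = g \<otimes>\<^bsub>free_product H G\<^esub> v \<otimes>\<^bsub>free_product H G\<^esub> inv\<^bsub>free_product H G\<^esub> g"
    using P.conj_class_sym[OF x v(1)] by (auto simp: conj_class_def)
  ultimately show ?thesis using P.centralizer_root_conj by blast
qed

end


section \<open>The classification\<close>

theorem mainTheorem2:
  fixes H :: "('a, 'm) monoid_scheme" and G :: "('b, 'n) monoid_scheme"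
  fixes P :: "('a + 'b) list monoid" and U :: "('a + 'b) list set set"
  assumes "group H" and "group G"
  defines "P \<equiv> free_product H G"
  defines "U \<equiv> {C \<in> conj_classes P.
      C \<inter> fp_inr G ` carrier G = {} \<and> C \<inter> fp_inl H ` carrier H = {}}"
  shows
    "inj_on (induced_class_map P (fp_inl H)) (conj_classes H - {conj_class H \<one>\<^bsub>H\<^esub>}) \<and>
     inj_on (induced_class_map P (fp_inr G)) (conj_classes G - {conj_class G \<one>\<^bsub>G\<^esub>}) \<and>
     (let E = {conj_class P \<one>\<^bsub>P\<^esub>};
          H' = induced_class_map P (fp_inl H) ` (conj_classes H - {conj_class H \<one>\<^bsub>H\<^esub>});
          G' = induced_class_map P (fp_inr G) ` (conj_classes G - {conj_class G \<one>\<^bsub>G\<^esub>})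
      in conj_classes P = E \<union> H' \<union> G' \<union> U \<and>
         E \<inter> H' = {} \<and> E \<inter> G' = {} \<and> E \<inter> U = {} \<and>
         H' \<inter> G' = {} \<and> H' \<inter> U = {} \<and> G' \<inter> U = {}) \<and>
     (\<forall>x\<in>carrier G. x \<noteq> \<one>\<^bsub>G\<^esub> \<longrightarrow>
        centralizer P (fp_inr G x) = fp_inr G ` centralizer G x) \<and>
     (\<forall>x\<in>carrier H. x \<noteq> \<one>\<^bsub>H\<^esub> \<longrightarrow>
        centralizer P (fp_inl H x) = fp_inl H ` centralizer H x) \<and>
     (\<forall>C\<in>U. \<forall>x\<in>C.
        max_root_exponent P x \<in> root_exponents P x \<and>
        (\<forall>k\<in>root_exponents P x. k \<le> max_root_exponent P x) \<and>
        pair_iso (centralizer_group P x) (generate P {x})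
          integer_group (range (\<lambda>m. max_root_exponent P x * m)) \<and>
        reduced_centralizer P x \<cong> integer_mod_group (nat (max_root_exponent P x)))"
proof -
  interpret free_factors H G by (rule free_factors.intro) fact+
  note homl = fp_inl_hom[OF H.is_group G.is_group] and homr = fp_inr_hom[OF H.is_group G.is_group]
  have il: "induced_class_map P (fp_inl H) (conj_class H h) = conj_class P (fp_inl H h)"
    if "h \<in> carrier H" for h
    unfolding P_def using that by (rule induced_class_map_conj_class[OF H.is_group P.is_group homl])
  have ir: "induced_class_map P (fp_inr G) (conj_class G g) = conj_class P (fp_inr G g)"
    if "g \<in> carrier G" for g
    unfolding P_def using that by (rule induced_class_map_conj_class[OF G.is_group P.is_group homr])
  have one: "fp_inl H \<one>\<^bsub>H\<^esub> = \<one>\<^bsub>P\<^esub>" "fp_inr G \<one>\<^bsub>G\<^esub> = \<one>\<^bsub>P\<^esub>"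
    by (simp_all add: P_def fp_inl_def fp_inr_def one_P)
  define E where "E = {conj_class P \<one>\<^bsub>P\<^esub>}"
  define H' where
    "H' = induced_class_map P (fp_inl H) ` (conj_classes H - {conj_class H \<one>\<^bsub>H\<^esub>})"
  define G' where
    "G' = induced_class_map P (fp_inr G) ` (conj_classes G - {conj_class G \<one>\<^bsub>G\<^esub>})"
  have nontrivH: "conj_class H h = conj_class H \<one>\<^bsub>H\<^esub> \<longleftrightarrow> h = \<one>\<^bsub>H\<^esub>" if "h \<in> carrier H" for h
    using that by (simp add: H.conj_class_eq_iff) (simp add: H.conj_class_one)
  have nontrivG: "conj_class G g = conj_class G \<one>\<^bsub>G\<^esub> \<longleftrightarrow> g = \<one>\<^bsub>G\<^esub>" if "g \<in> carrier G" for g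
    using that by (simp add: G.conj_class_eq_iff) (simp add: G.conj_class_one)
  have H'_eq: "H' = {conj_class P (fp_inl H h) | h. h \<in> carrier H \<and> h \<noteq> \<one>\<^bsub>H\<^esub>}"
  proof -
    have "conj_classes H - {conj_class H \<one>\<^bsub>H\<^esub>} = conj_class H ` {h \<in> carrier H. h \<noteq> \<one>\<^bsub>H\<^esub>}"
      using nontrivH by (auto simp: conj_classes_def)
    then have "H' = (\<lambda>h. induced_class_map P (fp_inl H) (conj_class H h)) ` {h \<in> carrier H. h \<noteq> \<one>\<^bsub>H\<^esub>}"
      by (simp add: H'_def image_image)
    also have "\<dots> = (\<lambda>h. conj_class P (fp_inl H h)) ` {h \<in> carrier H. h \<noteq> \<one>\<^bsub>H\<^esub>}"
      by (rule image_cong) (simp_all add: il)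
    finally show ?thesis by auto
  qed
  have G'_eq: "G' = {conj_class P (fp_inr G g) | g. g \<in> carrier G \<and> g \<noteq> \<one>\<^bsub>G\<^esub>}"
  proof -
    have "conj_classes G - {conj_class G \<one>\<^bsub>G\<^esub>} = conj_class G ` {g \<in> carrier G. g \<noteq> \<one>\<^bsub>G\<^esub>}"
      using nontrivG by (auto simp: conj_classes_def)
    then have "G' = (\<lambda>g. induced_class_map P (fp_inr G) (conj_class G g)) ` {g \<in> carrier G. g \<noteq> \<one>\<^bsub>G\<^esub>}"
      by (simp add: G'_def image_image)
    also have "\<dots> = (\<lambda>g. conj_class P (fp_inr G g)) ` {g \<in> carrier G. g \<noteq> \<one>\<^bsub>G\<^esub>}"
      by (rule image_cong) (simp_all add: ir)
    finally show ?thesis by auto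
  qed
  have selfl: "fp_inl H h \<in> conj_class P (fp_inl H h)" if "h \<in> carrier H" for h
    unfolding P_def using that by (intro P.conj_class_self fp_inl_closed)
  have selfr: "fp_inr G g \<in> conj_class P (fp_inr G g)" if "g \<in> carrier G" for g
    unfolding P_def using that by (intro P.conj_class_self fp_inr_closed)
  have injl: "inj_on (induced_class_map P (fp_inl H)) (conj_classes H - {conj_class H \<one>\<^bsub>H\<^esub>})"
    proof (rule inj_onI)
    fix A B assume "A \<in> conj_classes H - {conj_class H \<one>\<^bsub>H\<^esub>}" "B \<in> conj_classes H - {conj_class H \<one>\<^bsub>H\<^esub>}"
      and eq: "induced_class_map P (fp_inl H) A = induced_class_map P (fp_inl H) B"
    then obtain a b where "a \<in> carrier H" "A = conj_class H a" "b \<in> carrier H" "B = conj_class H b"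
      by (auto simp: conj_classes_def)
    then show "A = B" using eq conj_class_inl_iff by (simp add: il) (simp add: P_def)
  qed
  have injr: "inj_on (induced_class_map P (fp_inr G)) (conj_classes G - {conj_class G \<one>\<^bsub>G\<^esub>})"
    proof (rule inj_onI)
    fix A B assume "A \<in> conj_classes G - {conj_class G \<one>\<^bsub>G\<^esub>}" "B \<in> conj_classes G - {conj_class G \<one>\<^bsub>G\<^esub>}"
      and eq: "induced_class_map P (fp_inr G) A = induced_class_map P (fp_inr G) B"
    then obtain a b where "a \<in> carrier G" "A = conj_class G a" "b \<in> carrier G" "B = conj_class G b"
      by (auto simp: conj_classes_def)
    then show "A = B" using eq conj_class_inr_iff by (simp add: ir) (simp add: P_def)
  qed
  have U: "C \<in> U \<longleftrightarrow> C \<in> conj_classes P \<and>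
      (\<forall>g\<in>carrier G. fp_inr G g \<notin> C) \<and> (\<forall>h\<in>carrier H. fp_inl H h \<notin> C)" for C
    by (auto simp: U_def)
  have EH: "E \<inter> H' = {}"
    using conj_class_inl_iff[OF _ H.one_closed] nontrivH
    by (auto simp: E_def H'_eq P_def one(1)[unfolded P_def, symmetric])
  have EG: "E \<inter> G' = {}"
    using conj_class_inr_iff[OF _ G.one_closed] nontrivG
    by (auto simp: E_def G'_eq P_def one(2)[unfolded P_def, symmetric])
  have HG: "H' \<inter> G' = {}"
    using conj_class_inl_inr by (auto simp: H'_eq G'_eq P_def)
  have EU: "E \<inter> U = {}"
    using selfr[OF G.one_closed] by (auto simp: E_def U one(2)[symmetric])
  have HU: "H' \<inter> U = {}" unfolding H'_eq U_def using selfl by blast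
  have GU: "G' \<inter> U = {}" unfolding G'_eq U_def using selfr by blast
  have classl: "conj_class P (fp_inl H h) \<in> conj_classes P" if "h \<in> carrier H" for h
    using fp_inl_closed[OF that] by (auto simp: conj_classes_def P_def)
  have classr: "conj_class P (fp_inr G g) \<in> conj_classes P" if "g \<in> carrier G" for g
    using fp_inr_closed[OF that] by (auto simp: conj_classes_def P_def)
  have class_eq: "C = conj_class P y" if "C \<in> conj_classes P" "y \<in> C" for C y
    using that P.conj_class_eq by (auto simp: conj_classes_def P_def)
  have union: "conj_classes P = E \<union> H' \<union> G' \<union> U"
  proof
    show "E \<union> H' \<union> G' \<union> U \<subseteq> conj_classes P"
      using classl classr classr[OF G.one_closed] by (auto simp: E_def H'_eq G'_eq U one)
    show "conj_classes P \<subseteq> E \<union> H' \<union> G' \<union> U"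
    proof
      fix C assume C: "C \<in> conj_classes P"
      consider "C \<in> U" | g where "g \<in> carrier G" "fp_inr G g \<in> C"
        | h where "h \<in> carrier H" "fp_inl H h \<in> C"
        using C by (auto simp: U)
      then show "C \<in> E \<union> H' \<union> G' \<union> U"
      proof cases
        case (2 g)
        then show ?thesis
          using class_eq[OF C 2(2)] one by (cases "g = \<one>\<^bsub>G\<^esub>") (auto simp: E_def G'_eq)
      next
        case (3 h)
        then show ?thesis
          using class_eq[OF C 3(2)] one by (cases "h = \<one>\<^bsub>H\<^esub>") (auto simp: E_def H'_eq)
      qed simp
    qed
  qed
  have hyperbolic: "max_root_exponent P x \<in> root_exponents P x \<and>
        (\<forall>k\<in>root_exponents P x. k \<le> max_root_exponent P x) \<and>
        pair_iso (centralizer_group P x) (generate P {x})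
          integer_group (range (\<lambda>m. max_root_exponent P x * m)) \<and>
        reduced_centralizer P x \<cong> integer_mod_group (nat (max_root_exponent P x))"
    if "C \<in> U" "x \<in> C" for C x
  proof -
    have C: "C \<in> conj_classes P" using that(1) by (simp add: U)
    then have eq: "C = conj_class P x" using that(2) by (rule class_eq)
    have x: "x \<in> carrier P"
      using C that(2) P.conj_class_closed by (auto simp: conj_classes_def P_def)
    have "\<exists>z k. P.centralizer_root x z k"
      using that(1) x eq by (intro centralizer_root_exists) (auto simp: U_def P_def)
    then obtain z k where root: "P.centralizer_root x z k" by blast
    show ?thesis
      using P.root_exponents_max[OF root] P.centralizer_pair_iso[OF root]
        P.reduced_centralizer_iso[OF root] P.max_root_exponent_eq[OF root]
      unfolding pair_iso_def P_def by auto
  qed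
  show ?thesis
    unfolding Let_def E_def[symmetric] H'_def[symmetric] G'_def[symmetric]
    using injl injr union EH EG EU HG HU GU hyperbolic centralizer_inr centralizer_inl
    by (simp add: P_def)
qed

end
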